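(* Let $\mathbf{v}\in\mathbb{R}^{NM}$ be a fixed reference vector and let $\lambda,\lambda_1\in\mathbb{R}$ with $|\lambda-\lambda_1|=\epsilon\ll 1$. Let $\mathbf{A}=\mathbf{A}_0-\lambda\mathbf{J}$, where $\mathbf{A}_0$ is the $(N-2)(M-2)\times NM$ discretized Fokker--Planck matrix and $\mathbf{J}=[\,\mathbf{I}_{(N-2)(M-2)}\,|\,\mathbf{0}\,]$, and assume that $\mathbf{A}$ has full row rank. Let $\mathbf{u}$ be the solution of the optimization problem $$\min_{\mathbf{w}\in\mathbb{R}^{NM}}\ \|\mathbf{w}-\mathbf{v}\|^2\quad\text{subject to}\quad \mathbf{A}_0\mathbf{w}=\lambda\,\mathbf{J}\mathbf{w},$$ and let $\mathbf{u}_1$ be the solution of the same problem with $\lambda$ replaced by $\lambda_1$. Then $$\|\mathbf{u}-\mathbf{u}_1\|\le 2\,s_{\min}^{-1}\,\epsilon\,\|\mathbf{v}\|+O(\epsilon^2),$$ where $s_{\min}$ is the smallest singular value of $\mathbf{A}$. Here $O(\epsilon^2)$ is understood as $\epsilon\to0$ with $\mathbf{A}_0,\lambda,\mathbf{v}$ fixed.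
   Context: Let $N,M\ge 3$ be integers. A rectangle in $\mathbb{R}^2$ is divided into $N\times M$ boxes, and a vector in $\mathbb{R}^{NM}$ records one value per box. $\mathbf{A}_0$ is a real $(N-2)(M-2)\times NM$ matrix, each of whose rows is the finite difference scheme, at one non-boundary grid point, of the operator $\mathcal{L}u=-\sum_i (f_iu)_{x_i}+\frac12\sum_{i,j}(D_{ij}u)_{x_ix_j}$ in the equation $\mathcal{L}u=-\lambda u$ (the sign being absorbed into the convention for $\lambda$). No specific finite difference scheme is prescribed, so $\mathbf{A}_0$ may be treated as an arbitrary real matrix of this size for which $\mathbf{A}=\mathbf{A}_0-\lambda\mathbf{J}$ has full row rank. The coordinates of $\mathbb{R}^{NM}$ are ordered so that the $(N-2)(M-2)$ non-boundary grid points come first; thus $\mathbf{J}$ is the $(N-2)(M-2)\times NM$ matrix restricting a vector to the non-boundary points. The norm $\|\cdot\|$ is the Euclidean norm. The smallest singular value of $\mathbf{A}$ is the smallest of its $(N-2)(M-2)$ singular values, so $s_{\min}>0$ under full row rank. The solution of the optimization problem is $\mathbf{u}=\mathbf{v}-\mathbf{A}^T(\mathbf{A}\mathbf{A}^T)^{-1}\mathbf{A}\mathbf{v}$. *)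

theory Defs
  imports
    "Jordan_Normal_Form.DL_Rank"
    "Jordan_Normal_Form.Char_Poly"
    "HOL-Library.Landau_Symbols"
begin

definition euclidean_norm :: "real vec \<Rightarrow> real" where
  "euclidean_norm x = sqrt (x \<bullet> x)"

text \<open>The block matrix \<open>[I | 0]\<close> with \<open>r\<close> rows and \<open>c \<ge> r\<close> columns; it restricts a
  vector to its first \<open>r\<close> coordinates, which are the non-boundary grid points.\<close>

definition restriction_mat :: "nat \<Rightarrow> nat \<Rightarrow> real mat" where
  "restriction_mat r c = mat r c (\<lambda>(i, j). if i = j then 1 else 0)"

text \<open>\<^const>\<open>vec_space.rank\<close> takes the dimension of the space containing the columns, that is,
  the number of rows.\<close>

definition full_row_rank :: "real mat \<Rightarrow> bool" where
  "full_row_rank A \<longleftrightarrow> vec_space.rank (dim_row A) A = dim_row A"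

text \<open>The singular values of a matrix with at most as many rows as columns. It has
  \<open>dim_row A\<close> of them, counted with multiplicity, so they come from \<open>A A\<^sup>T\<close>; using \<open>A\<^sup>T A\<close>
  instead would add zeros when there are fewer rows than columns.\<close>

definition singular_values :: "real mat \<Rightarrow> real set" where
  "singular_values A = {sqrt k |k. eigenvalue (A * A\<^sup>T) k}"

definition smallest_singular_value :: "real mat \<Rightarrow> real" where
  "smallest_singular_value A = Min (singular_values A)"

text \<open>\<open>u\<close> minimizes \<open>\<parallel>w - v\<parallel>\<^sup>2\<close> over all \<open>w\<close> of the dimension of \<open>v\<close> with
  \<open>A\<^sub>0 w = \<lambda> J w\<close>.\<close>

definition is_solution :: "real mat \<Rightarrow> real mat \<Rightarrow> real vec \<Rightarrow> real \<Rightarrow> real vec \<Rightarrow> bool" where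
  "is_solution A0 J v lam u \<longleftrightarrow>
     is_arg_min (\<lambda>w. (euclidean_norm (w - v))\<^sup>2)
       (\<lambda>w. w \<in> carrier_vec (dim_vec v) \<and> A0 *\<^sub>v w = lam \<cdot>\<^sub>v (J *\<^sub>v w)) u"

end

theory Submission
  imports Defs
begin

text \<open>
  The solution \<open>u\<close> is the orthogonal projection of \<open>v\<close> onto the kernel of \<open>A = A0 - lam J\<close>, and
  \<open>u1\<close> is the projection onto the kernel of \<open>A1 = A0 - lam1 J = A + d J\<close>, where \<open>d = lam - lam1\<close>,
  so the theorem compares two projections. Split \<open>\<Delta> = u - u1\<close> into its parts in the row space and
  in the kernel of \<open>A\<close>. Since \<open>A1 u1 = 0\<close>, the vector \<open>A \<Delta> = d J u1\<close> has norm at most \<open>\<epsilon> \<parallel>v\<parallel>\<close>,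
  and dividing by the smallest singular value \<open>s\<close> bounds the row space part. For the kernel part,
  \<open>v - u1 = A1\<^sup>T y1\<close> for some multiplier \<open>y1\<close>, and only \<open>d J\<^sup>T y1\<close> contributes to the kernel of
  \<open>A\<close>; the smallest singular value of \<open>A1\<close> is at least \<open>s - \<epsilon>\<close>, so \<open>\<parallel>y1\<parallel> \<le> \<parallel>v\<parallel> / (s - \<epsilon>)\<close>. Hence
  \<open>\<parallel>\<Delta>\<parallel> \<le> (\<epsilon> / s + \<epsilon> / (s - \<epsilon>)) \<parallel>v\<parallel>\<close>, which is lemma \<open>kernel_projection_perturbation\<close>, and
  expanding the second quotient yields the claim with the remainder \<open>4 \<parallel>v\<parallel> \<epsilon>\<^sup>2 / s\<^sup>2\<close>.

  The remainder has to be valid for every \<open>\<epsilon>\<close>, not only near \<open>0\<close>. For \<open>\<epsilon> > s / 2\<close>, where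
  \<open>A1\<close> may lose full row rank, it suffices that \<open>0\<close> is feasible for both problems, so that
  \<open>\<parallel>\<Delta>\<parallel> \<le> 2 \<parallel>v\<parallel>\<close> (lemma \<open>solution_distance_le\<close>).

  The link between singular values and the estimate is \<open>s \<parallel>y\<parallel> \<le> \<parallel>A\<^sup>T y\<parallel>\<close>
  (lemma \<open>smallest_singular_value_lower_bound\<close>). As \<open>s\<close> is defined through the eigenvalues of
  \<open>A A\<^sup>T\<close>, it rests on the fact that the infimum of the Rayleigh quotient of a symmetric matrix is
  an eigenvalue (lemma \<open>symmetric_mat_min_eigenvalue\<close>).
\<close>

section \<open>The Euclidean norm and positive semidefinite forms\<close>

lemma scalar_prod_self_nonneg: "0 \<le> x \<bullet> (x :: real vec)"
  unfolding scalar_prod_def by (intro sum_nonneg) simp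

lemma euclidean_norm_nonneg [simp]: "0 \<le> euclidean_norm x"
  unfolding euclidean_norm_def by (simp add: scalar_prod_self_nonneg)

lemma euclidean_norm_power2: "(euclidean_norm x)\<^sup>2 = x \<bullet> x"
  unfolding euclidean_norm_def by (simp add: scalar_prod_self_nonneg)

lemma euclidean_norm_eq_0_iff:
  assumes "x \<in> carrier_vec n"
  shows "euclidean_norm x = 0 \<longleftrightarrow> x = 0\<^sub>v n"
proof
  assume "euclidean_norm x = 0"
  then have "x \<bullet> x = 0"
    using euclidean_norm_power2[of x] by simp
  then have "(\<Sum>i = 0..<n. x $ i * x $ i) = 0"
    using assms by (simp add: scalar_prod_def)
  then have "\<forall>i\<in>{0..<n}. x $ i * x $ i = 0"
    by (subst (asm) sum_nonneg_eq_0_iff) auto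
  then show "x = 0\<^sub>v n"
    using assms by (intro eq_vecI) auto
next
  assume "x = 0\<^sub>v n"
  then show "euclidean_norm x = 0"
    by (simp add: euclidean_norm_def)
qed

lemma euclidean_norm_smult: "euclidean_norm (k \<cdot>\<^sub>v x) = \<bar>k\<bar> * euclidean_norm x"
  by (simp add: euclidean_norm_def real_sqrt_mult flip: mult.assoc)

lemma symmetric_mat_scalar_prod:
  fixes C :: "real mat"
  assumes "C \<in> carrier_mat n n" "C\<^sup>T = C" "x \<in> carrier_vec n" "y \<in> carrier_vec n"
  shows "x \<bullet> (C *\<^sub>v y) = y \<bullet> (C *\<^sub>v x)"
proof -
  have "x \<bullet> (C *\<^sub>v y) = (C *\<^sub>v x) \<bullet> y"
    using transpose_vec_mult_scalar[of C n n y x] assms by simp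
  also have "\<dots> = y \<bullet> (C *\<^sub>v x)"
    using assms by (intro comm_scalar_prod) auto
  finally show ?thesis .
qed

text \<open>A nonnegative parabola has nonpositive discriminant; when \<open>c = 0\<close> it degenerates to a line,
  which is bounded below only if it is constant.\<close>

lemma nonneg_quadratic_discriminant:
  fixes a b c :: real
  assumes q: "\<And>t. 0 \<le> a + 2 * t * b + t\<^sup>2 * c" and "0 \<le> c"
  shows "b\<^sup>2 \<le> a * c"
proof (cases "c = 0")
  case True
  have "b = 0"
  proof (rule ccontr)
    assume "b \<noteq> 0"
    then show False
      using q[of "- (a + 1) / (2 * b)"] True by (simp add: field_simps)
  qed
  then show ?thesis using True by simp
next
  case False
  with assms(2) have "0 < c" by simp
  have "0 \<le> a - b\<^sup>2 / c"
    using q[of "- b / c"] \<open>0 < c\<close> by (simp add: field_simps power2_eq_square)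
  with \<open>0 < c\<close> show ?thesis by (simp add: field_simps)
qed

text \<open>The form \<open>(x, y) \<mapsto> x \<bullet> C y\<close> of a positive semidefinite matrix is a possibly degenerate inner
  product, so the discriminant argument for \<open>x + t y\<close> applies. With \<open>C = I\<close> this is the usual
  inequality; its second use is to turn smallness of \<open>x \<bullet> C x\<close> into smallness of \<open>C x\<close>.\<close>

lemma psd_Cauchy_Schwarz:
  fixes C :: "real mat"
  assumes C: "C \<in> carrier_mat n n" "C\<^sup>T = C"
    and psd: "\<And>z. z \<in> carrier_vec n \<Longrightarrow> 0 \<le> z \<bullet> (C *\<^sub>v z)"
    and x: "x \<in> carrier_vec n" and y: "y \<in> carrier_vec n"
  shows "(x \<bullet> (C *\<^sub>v y))\<^sup>2 \<le> (x \<bullet> (C *\<^sub>v x)) * (y \<bullet> (C *\<^sub>v y))"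
proof (rule nonneg_quadratic_discriminant)
  fix t :: real
  have "0 \<le> (x + t \<cdot>\<^sub>v y) \<bullet> (C *\<^sub>v (x + t \<cdot>\<^sub>v y))"
    using x y by (intro psd) auto
  also have "\<dots> = x \<bullet> (C *\<^sub>v x) + 2 * t * (x \<bullet> (C *\<^sub>v y)) + t\<^sup>2 * (y \<bullet> (C *\<^sub>v y))"
    using C x y symmetric_mat_scalar_prod[OF C x y]
    by (simp add: mult_add_distrib_mat_vec[of _ n n] mult_mat_vec[of _ n n]
        scalar_prod_add_distrib[of _ n] add_scalar_prod_distrib[of _ n] power2_eq_square
        algebra_simps)
  finally show "0 \<le> x \<bullet> (C *\<^sub>v x) + 2 * t * (x \<bullet> (C *\<^sub>v y)) + t\<^sup>2 * (y \<bullet> (C *\<^sub>v y))" .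
qed (rule psd[OF y])

lemma scalar_prod_le_euclidean_norm:
  assumes x: "x \<in> carrier_vec n" and y: "y \<in> carrier_vec n"
  shows "\<bar>x \<bullet> y\<bar> \<le> euclidean_norm x * euclidean_norm y"
proof (rule power2_le_imp_le)
  have "(x \<bullet> y)\<^sup>2 \<le> (x \<bullet> x) * (y \<bullet> y)"
    using psd_Cauchy_Schwarz[of "1\<^sub>m n" n x y] x y by (simp add: scalar_prod_self_nonneg)
  then show "\<bar>x \<bullet> y\<bar>\<^sup>2 \<le> (euclidean_norm x * euclidean_norm y)\<^sup>2"
    by (simp add: power_mult_distrib euclidean_norm_power2)
qed simp

lemma euclidean_norm_triangle:
  assumes x: "x \<in> carrier_vec n" and y: "y \<in> carrier_vec n"
  shows "euclidean_norm (x + y) \<le> euclidean_norm x + euclidean_norm y"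
proof (rule power2_le_imp_le)
  have "(euclidean_norm (x + y))\<^sup>2 = x \<bullet> x + 2 * (x \<bullet> y) + y \<bullet> y"
    using x y comm_scalar_prod[OF x y]
    by (simp add: euclidean_norm_power2 scalar_prod_add_distrib[of _ n]
        add_scalar_prod_distrib[of _ n])
  also have "\<dots> \<le> (euclidean_norm x + euclidean_norm y)\<^sup>2"
    using scalar_prod_le_euclidean_norm[OF x y]
    by (simp add: power2_sum euclidean_norm_power2)
  finally show "(euclidean_norm (x + y))\<^sup>2 \<le> (euclidean_norm x + euclidean_norm y)\<^sup>2" .
qed simp

text \<open>By Cauchy--Schwarz on each row, the Frobenius norm is a bound; the extra \<open>1\<close> under the root
  only makes the constant positive.\<close>

lemma mat_bounded:
  fixes B :: "real mat"
  assumes "B \<in> carrier_mat n c"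
  obtains K where "0 < K" "\<And>x. x \<in> carrier_vec c \<Longrightarrow> euclidean_norm (B *\<^sub>v x) \<le> K * euclidean_norm x"
proof
  let ?S = "\<Sum>i = 0..<n. (euclidean_norm (row B i))\<^sup>2"
  have S: "0 \<le> ?S" by (intro sum_nonneg) simp
  then show "0 < sqrt (?S + 1)" by simp
  fix x :: "real vec" assume x: "x \<in> carrier_vec c"
  show "euclidean_norm (B *\<^sub>v x) \<le> sqrt (?S + 1) * euclidean_norm x"
  proof (rule power2_le_imp_le)
    have "(euclidean_norm (B *\<^sub>v x))\<^sup>2 = (\<Sum>i = 0..<n. (row B i \<bullet> x)\<^sup>2)"
      using assms x unfolding euclidean_norm_power2
      by (simp add: scalar_prod_def[of "B *\<^sub>v x"] power2_eq_square)
    also have "\<dots> \<le> (\<Sum>i = 0..<n. (euclidean_norm (row B i))\<^sup>2 * (euclidean_norm x)\<^sup>2)"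
    proof (rule sum_mono)
      fix i assume "i \<in> {0..<n}"
      then have "row B i \<in> carrier_vec c" using assms by auto
      from scalar_prod_le_euclidean_norm[OF this x]
      have "\<bar>row B i \<bullet> x\<bar>\<^sup>2 \<le> (euclidean_norm (row B i) * euclidean_norm x)\<^sup>2"
        by (intro power_mono) auto
      then show "(row B i \<bullet> x)\<^sup>2 \<le> (euclidean_norm (row B i))\<^sup>2 * (euclidean_norm x)\<^sup>2"
        by (simp add: power_mult_distrib)
    qed
    also have "\<dots> = ?S * (euclidean_norm x)\<^sup>2"
      by (simp add: sum_distrib_right)
    also have "\<dots> \<le> (?S + 1) * (euclidean_norm x)\<^sup>2"
      by (intro mult_right_mono) auto
    also have "\<dots> = (sqrt (?S + 1) * euclidean_norm x)\<^sup>2"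
      using S by (simp add: power_mult_distrib)
    finally show "(euclidean_norm (B *\<^sub>v x))\<^sup>2 \<le> (sqrt (?S + 1) * euclidean_norm x)\<^sup>2" .
  qed (use S in simp)
qed

section \<open>The smallest eigenvalue of a symmetric matrix\<close>

lemma injective_mat_inverse:
  fixes C :: "real mat"
  assumes C: "C \<in> carrier_mat n n"
    and inj: "\<And>x. x \<in> carrier_vec n \<Longrightarrow> C *\<^sub>v x = 0\<^sub>v n \<Longrightarrow> x = 0\<^sub>v n"
  obtains E where "E \<in> carrier_mat n n" "C * E = 1\<^sub>m n" "E * C = 1\<^sub>m n"
proof -
  have "det C \<noteq> 0"
    using det_0_iff_vec_prod_zero_field[OF C] inj by blast
  from det_non_zero_imp_unit[OF C this, of "()"] show ?thesis
    using that unfolding Units_def ring_mat_def by auto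
qed

text \<open>Let \<open>m\<close> be the infimum of the Rayleigh quotient, so that \<open>D = C - m I\<close> is positive semidefinite. If \<open>m\<close> were not an
  eigenvalue, \<open>D\<close> would have a bounded inverse, so \<open>\<parallel>D x\<parallel>\<close> would stay away from \<open>0\<close> on unit
  vectors. Cauchy--Schwarz for the form of \<open>D\<close>, applied to \<open>x\<close> and \<open>D x\<close>, gives
  \<open>\<parallel>D x\<parallel>\<^sup>4 \<le> (x \<bullet> D x) K \<parallel>D x\<parallel>\<^sup>2\<close>, so \<open>x \<bullet> D x\<close> would stay away from \<open>0\<close> too,
  and \<open>m\<close> would not be the infimum.\<close>

lemma symmetric_mat_min_eigenvalue:
  fixes C :: "real mat"
  assumes C: "C \<in> carrier_mat n n" "C\<^sup>T = C" and n: "0 < n"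
  obtains m where "eigenvalue C m" "\<And>x. x \<in> carrier_vec n \<Longrightarrow> m * (x \<bullet> x) \<le> x \<bullet> (C *\<^sub>v x)"
proof -
  define Q where "Q = {x \<bullet> (C *\<^sub>v x) |x. x \<in> carrier_vec n \<and> x \<bullet> x = 1}"
  define m where "m = Inf Q"
  define D where "D = char_matrix C m"
  obtain KC where KC: "\<And>x. x \<in> carrier_vec n \<Longrightarrow> euclidean_norm (C *\<^sub>v x) \<le> KC * euclidean_norm x"
    using mat_bounded[OF C(1)] by metis
  have "bdd_below Q"
  proof (rule bdd_belowI)
    fix r assume "r \<in> Q"
    then obtain x where x: "x \<in> carrier_vec n" "x \<bullet> x = 1" "r = x \<bullet> (C *\<^sub>v x)"
      unfolding Q_def by auto
    then have "euclidean_norm x = 1" by (simp add: euclidean_norm_def)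
    then have "\<bar>r\<bar> \<le> KC"
      using scalar_prod_le_euclidean_norm[of x n "C *\<^sub>v x"] KC[OF x(1)] x C(1) by simp
    then show "- KC \<le> r" by simp
  qed
  have ne: "Q \<noteq> {}"
    using n unfolding Q_def by (auto intro!: exI[of _ "unit_vec n 0"])
  have D: "D \<in> carrier_mat n n" using C(1) by (simp add: D_def)
  have Dx: "x \<bullet> (D *\<^sub>v y) = x \<bullet> (C *\<^sub>v y) - m * (x \<bullet> y)"
    if "x \<in> carrier_vec n" "y \<in> carrier_vec n" for x y
  proof -
    have "D *\<^sub>v y = C *\<^sub>v y + (- m) \<cdot>\<^sub>v y"
      using that C(1) unfolding D_def char_matrix_def
      by (intro eq_vecI) (auto simp: add_scalar_prod_distrib[of _ n])
    then show ?thesis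
      using that C(1) by (simp add: scalar_prod_add_distrib[of _ n])
  qed
  have Dsym: "D\<^sup>T = D"
  proof (rule eq_matI)
    fix i j assume ij: "i < dim_row D" "j < dim_col D"
    have "C $$ (j, i) = C $$ (i, j)"
      using arg_cong[OF C(2), of "\<lambda>M. M $$ (i, j)"] ij C(1) D by auto
    then show "D\<^sup>T $$ (i, j) = D $$ (i, j)"
      using ij C(1) D unfolding D_def char_matrix_def by auto
  qed (use D in auto)
  have scale: "\<exists>r\<in>Q. x \<bullet> (C *\<^sub>v x) = r * (x \<bullet> x)" if x: "x \<in> carrier_vec n" "x \<noteq> 0\<^sub>v n" for x
  proof -
    have e: "euclidean_norm x \<noteq> 0" using x euclidean_norm_eq_0_iff by auto
    define z where "z = inverse (euclidean_norm x) \<cdot>\<^sub>v x"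
    have z: "z \<in> carrier_vec n" using x by (simp add: z_def)
    have "euclidean_norm z = 1"
      using e by (simp add: z_def euclidean_norm_smult)
    then have "z \<bullet> z = 1" using euclidean_norm_power2[of z] by simp
    moreover have "z \<bullet> (C *\<^sub>v z) * (x \<bullet> x) = x \<bullet> (C *\<^sub>v x)"
      using x C(1) e unfolding z_def euclidean_norm_power2[symmetric]
      by (simp add: mult_mat_vec[of _ n n] power2_eq_square field_simps)
    ultimately show ?thesis using z unfolding Q_def by (auto intro!: exI[of _ z])
  qed
  have low: "m * (x \<bullet> x) \<le> x \<bullet> (C *\<^sub>v x)" if x: "x \<in> carrier_vec n" for x
  proof (cases "x = 0\<^sub>v n")
    case True
    then show ?thesis using C(1) by simp
  next
    case False
    then obtain r where r: "r \<in> Q" "x \<bullet> (C *\<^sub>v x) = r * (x \<bullet> x)" using scale[OF x] by auto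
    have "m \<le> r" unfolding m_def using r(1) \<open>bdd_below Q\<close> by (rule cInf_lower)
    then show ?thesis unfolding r(2) by (intro mult_right_mono) (auto simp: scalar_prod_self_nonneg)
  qed
  have psd: "0 \<le> x \<bullet> (D *\<^sub>v x)" if "x \<in> carrier_vec n" for x
    using Dx[OF that that] low[OF that] by simp
  have "eigenvalue C m"
  proof (rule ccontr)
    assume "\<not> eigenvalue C m"
    then have inj: "\<And>x. x \<in> carrier_vec n \<Longrightarrow> D *\<^sub>v x = 0\<^sub>v n \<Longrightarrow> x = 0\<^sub>v n"
      unfolding eigenvalue_char_matrix[OF C(1)] D_def by auto
    obtain E where E: "E \<in> carrier_mat n n" "E * D = 1\<^sub>m n"
      using injective_mat_inverse[OF D inj] by metis
    obtain L where L: "0 < L" "\<And>x. x \<in> carrier_vec n \<Longrightarrow> euclidean_norm (E *\<^sub>v x) \<le> L * euclidean_norm x"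
      using mat_bounded[OF E(1)] by metis
    obtain K where K: "0 < K" "\<And>x. x \<in> carrier_vec n \<Longrightarrow> euclidean_norm (D *\<^sub>v x) \<le> K * euclidean_norm x"
      using mat_bounded[OF D] by metis
    \<comment> \<open>\<open>L\<close> bounds the inverse of \<open>D\<close>, so \<open>1 / L\<close> bounds \<open>\<parallel>D x\<parallel>\<close> from below.\<close>
    have "m + 1 / (K * L\<^sup>2) \<le> r" if "r \<in> Q" for r
    proof -
      from that obtain x where x: "x \<in> carrier_vec n" "x \<bullet> x = 1" and r: "r = x \<bullet> (C *\<^sub>v x)"
        unfolding Q_def by auto
      let ?y = "D *\<^sub>v x"
      have y: "?y \<in> carrier_vec n" using D x by simp
      have "E *\<^sub>v ?y = x"
        using assoc_mult_mat_vec[OF E(1) D x(1)] E(2) x by simp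
      then have "1 \<le> L * euclidean_norm ?y"
        using L(2)[OF y] x(2) by (simp add: euclidean_norm_def)
      then have "1\<^sup>2 \<le> (L * euclidean_norm ?y)\<^sup>2"
        by (intro power_mono) auto
      then have y2: "1 / L\<^sup>2 \<le> ?y \<bullet> ?y"
        using L(1) by (simp add: power_mult_distrib euclidean_norm_power2 field_simps)
      moreover have "0 < 1 / L\<^sup>2" using L(1) by simp
      ultimately have pos: "0 < ?y \<bullet> ?y" by linarith
      have "(?y \<bullet> ?y)\<^sup>2 \<le> (?y \<bullet> (D *\<^sub>v ?y)) * (x \<bullet> (D *\<^sub>v x))"
        by (rule psd_Cauchy_Schwarz[OF D Dsym psd y x(1)])
      also have "\<dots> \<le> (K * (?y \<bullet> ?y)) * (x \<bullet> (D *\<^sub>v x))"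
      proof (rule mult_right_mono[OF _ psd[OF x(1)]])
        have "?y \<bullet> (D *\<^sub>v ?y) \<le> euclidean_norm ?y * euclidean_norm (D *\<^sub>v ?y)"
          using scalar_prod_le_euclidean_norm[of ?y n "D *\<^sub>v ?y"] D y by simp
        also have "\<dots> \<le> euclidean_norm ?y * (K * euclidean_norm ?y)"
          using K(2)[OF y] by (intro mult_left_mono) auto
        also have "\<dots> = K * (?y \<bullet> ?y)"
          by (simp flip: euclidean_norm_power2 add: power2_eq_square)
        finally show "?y \<bullet> (D *\<^sub>v ?y) \<le> K * (?y \<bullet> ?y)" .
      qed
      finally have "?y \<bullet> ?y \<le> K * (x \<bullet> (D *\<^sub>v x))"
        using pos by (simp add: power2_eq_square)
      with y2 have "1 / L\<^sup>2 \<le> K * (x \<bullet> (D *\<^sub>v x))" by linarith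
      then have "1 / (K * L\<^sup>2) \<le> x \<bullet> (D *\<^sub>v x)"
        using K(1) L(1) by (simp add: field_simps)
      then show ?thesis using Dx[OF x(1) x(1)] x(2) r by simp
    qed
    then have "m + 1 / (K * L\<^sup>2) \<le> m"
      unfolding m_def using ne by (intro cInf_greatest) auto
    then show False using K(1) L(1) by (simp add: field_simps)
  qed
  with low show ?thesis using that by blast
qed

section \<open>Full row rank and the smallest singular value\<close>

text \<open>If \<open>A\<^sup>T y = 0\<close> then \<open>y\<close> is orthogonal to all columns of \<open>A\<close>. Full row rank says that the columns
  span the whole space, so \<open>y\<close> is orthogonal to itself.\<close>

lemma full_row_rank_transpose_injective:
  assumes A: "A \<in> carrier_mat n c" and rank: "full_row_rank A"
    and y: "y \<in> carrier_vec n" and 0: "A\<^sup>T *\<^sub>v y = 0\<^sub>v c"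
  shows "y = 0\<^sub>v n"
proof -
  interpret vec_space "TYPE(real)" n .
  have cols: "set (cols A) \<subseteq> carrier_vec n"
    using cols_dim[of A] A by simp
  \<comment> \<open>A maximal independent set of columns has \<open>n\<close> elements, hence is a basis.\<close>
  obtain S where S: "maximal S (\<lambda>T. T \<subseteq> set (cols A) \<and> lin_indpt T)"
    using maximal_exists_superset[of "set (cols A)" "\<lambda>T. T \<subseteq> set (cols A) \<and> lin_indpt T" "{}"]
      finite_lin_indpt2[of "{}"] by auto
  then have S': "S \<subseteq> set (cols A)" "lin_indpt S"
    unfolding maximal_def by auto
  have "card S = n"
    using rank_card_indpt[OF A S] rank A unfolding full_row_rank_def by simp
  then have "basis S"
    using S' cols finite_subset[OF S'(1)]
    by (intro dim_li_is_basis) (auto simp: dim_is_n)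
  then have "y \<in> span S"
    using y unfolding basis_def by simp
  moreover have "y \<in> orthogonal_complement S"
  proof -
    have "y \<bullet> w = 0" if "w \<in> S" for w
    proof -
      from that S'(1) obtain j where j: "j < c" "w = col A j"
        using A by (auto simp: cols_def)
      have "(A\<^sup>T *\<^sub>v y) $ j = 0" using 0 j by simp
      then have "col A j \<bullet> y = 0" using j A by simp
      then show ?thesis
        using comm_scalar_prod[of y n w] y j A by auto
    qed
    then show ?thesis using y unfolding orthogonal_complement_def by auto
  qed
  ultimately have "y \<bullet> y = 0"
    using in_orthogonal_complement_span[of S] S'(1) cols
    unfolding orthogonal_complement_def by auto
  then show ?thesis
    using euclidean_norm_eq_0_iff[OF y] by (simp add: euclidean_norm_def)
qed

lemma gram_scalar_prod:
  fixes A :: "real mat"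
  assumes "A \<in> carrier_mat n c" "x \<in> carrier_vec n" "y \<in> carrier_vec n"
  shows "x \<bullet> ((A * A\<^sup>T) *\<^sub>v y) = (A\<^sup>T *\<^sub>v x) \<bullet> (A\<^sup>T *\<^sub>v y)"
  using assms transpose_vec_mult_scalar[of A n c "A\<^sup>T *\<^sub>v y" x] by simp

text \<open>The quadratic form of \<open>A A\<^sup>T\<close> at \<open>y\<close> is \<open>\<parallel>A\<^sup>T y\<parallel>\<^sup>2\<close>, so the bound is the Rayleigh bound for
  \<open>A A\<^sup>T\<close>. Positivity holds because \<open>A A\<^sup>T x = k x\<close> implies \<open>\<parallel>A\<^sup>T x\<parallel>\<^sup>2 = k \<parallel>x\<parallel>\<^sup>2\<close>,
  where the left side is nonzero by injectivity of \<open>A\<^sup>T\<close>.\<close>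

lemma smallest_singular_value_lower_bound:
  assumes A: "A \<in> carrier_mat n c" and n: "0 < n" and rank: "full_row_rank A"
  shows "0 < smallest_singular_value A"
    and "y \<in> carrier_vec n \<Longrightarrow>
      smallest_singular_value A * euclidean_norm y \<le> euclidean_norm (A\<^sup>T *\<^sub>v y)"
proof -
  let ?B = "A * A\<^sup>T" and ?s = "smallest_singular_value A"
  have B: "?B \<in> carrier_mat n n" using A by simp
  have sym: "?B\<^sup>T = ?B" using A by (simp add: transpose_mult[of _ n c])
  obtain m where m: "eigenvalue ?B m"
    "\<And>x. x \<in> carrier_vec n \<Longrightarrow> m * (x \<bullet> x) \<le> x \<bullet> (?B *\<^sub>v x)"
    using symmetric_mat_min_eigenvalue[OF B sym n] by metis
  have "char_poly ?B \<noteq> 0"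
    using degree_monic_char_poly[OF B] by auto
  then have "finite {k. eigenvalue ?B k}"
    using poly_roots_finite unfolding eigenvalue_root_char_poly[OF B] by blast
  then have fin: "finite (singular_values A)"
    unfolding singular_values_def by (simp add: setcompr_eq_image)
  have mem: "sqrt m \<in> singular_values A"
    using m(1) unfolding singular_values_def by auto
  have pos: "0 < k" if k: "eigenvalue ?B k" for k
  proof -
    from k obtain x where x: "x \<in> carrier_vec n" "x \<noteq> 0\<^sub>v n" "?B *\<^sub>v x = k \<cdot>\<^sub>v x"
      using B unfolding eigenvalue_def eigenvector_def by auto
    have "A\<^sup>T *\<^sub>v x \<noteq> 0\<^sub>v c"
      using full_row_rank_transpose_injective[OF A rank x(1)] x(2) by auto
    then have "euclidean_norm (A\<^sup>T *\<^sub>v x) \<noteq> 0"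
      using euclidean_norm_eq_0_iff[of "A\<^sup>T *\<^sub>v x" c] A x(1) by auto
    then have "0 < (A\<^sup>T *\<^sub>v x) \<bullet> (A\<^sup>T *\<^sub>v x)"
      unfolding euclidean_norm_power2[symmetric] by simp
    also have "\<dots> = k * (x \<bullet> x)"
      using gram_scalar_prod[OF A x(1) x(1)] x by simp
    finally show "0 < k"
      using scalar_prod_self_nonneg[of x] by (simp add: zero_less_mult_iff)
  qed
  have "?s \<in> singular_values A"
    unfolding smallest_singular_value_def using fin mem by (intro Min_in) auto
  then show s: "0 < ?s"
    using pos unfolding singular_values_def by auto
  have "?s \<le> sqrt m"
    unfolding smallest_singular_value_def using fin mem by (intro Min_le)
  then have "?s\<^sup>2 \<le> (sqrt m)\<^sup>2"
    using s by (intro power_mono) auto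
  then have sm: "?s\<^sup>2 \<le> m" using pos[OF m(1)] by simp
  assume y: "y \<in> carrier_vec n"
  show "?s * euclidean_norm y \<le> euclidean_norm (A\<^sup>T *\<^sub>v y)"
  proof (rule power2_le_imp_le)
    have "(?s * euclidean_norm y)\<^sup>2 \<le> m * (y \<bullet> y)"
      using sm by (simp add: power_mult_distrib euclidean_norm_power2 mult_right_mono
          scalar_prod_self_nonneg)
    also have "\<dots> \<le> (euclidean_norm (A\<^sup>T *\<^sub>v y))\<^sup>2"
      using m(2)[OF y] gram_scalar_prod[OF A y y] by (simp add: euclidean_norm_power2)
    finally show "(?s * euclidean_norm y)\<^sup>2 \<le> (euclidean_norm (A\<^sup>T *\<^sub>v y))\<^sup>2" .
  qed simp
qed

section \<open>Least-squares solutions as kernel components\<close>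

text \<open>The coefficient vector is \<open>y = (A A\<^sup>T)\<^sup>-\<^sup>1 A x\<close>, which exists since \<open>A A\<^sup>T\<close> inherits
  injectivity from \<open>A\<^sup>T\<close>.\<close>

lemma row_space_kernel_decomposition:
  fixes A :: "real mat"
  assumes A: "A \<in> carrier_mat n c"
    and inj: "\<And>y. y \<in> carrier_vec n \<Longrightarrow> A\<^sup>T *\<^sub>v y = 0\<^sub>v c \<Longrightarrow> y = 0\<^sub>v n"
    and x: "x \<in> carrier_vec c"
  obtains y k where "y \<in> carrier_vec n" "k \<in> carrier_vec c" "x = k + A\<^sup>T *\<^sub>v y" "A *\<^sub>v k = 0\<^sub>v n"
proof -
  have B: "A * A\<^sup>T \<in> carrier_mat n n" using A by simp
  have inj': "y = 0\<^sub>v n" if y: "y \<in> carrier_vec n" and "(A * A\<^sup>T) *\<^sub>v y = 0\<^sub>v n" for y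
  proof (rule inj[OF y])
    have "(A\<^sup>T *\<^sub>v y) \<bullet> (A\<^sup>T *\<^sub>v y) = 0"
      using gram_scalar_prod[OF A y y] that by simp
    then show "A\<^sup>T *\<^sub>v y = 0\<^sub>v c"
      using euclidean_norm_eq_0_iff[of "A\<^sup>T *\<^sub>v y" c] A y by (simp add: euclidean_norm_def)
  qed
  obtain E where E: "E \<in> carrier_mat n n" "(A * A\<^sup>T) * E = 1\<^sub>m n"
    using injective_mat_inverse[OF B inj'] by metis
  define y where "y = E *\<^sub>v (A *\<^sub>v x)"
  define k where "k = x - A\<^sup>T *\<^sub>v y"
  have y: "y \<in> carrier_vec n" and k: "k \<in> carrier_vec c"
    using A E(1) x by (auto simp: y_def k_def)
  have "A *\<^sub>v (A\<^sup>T *\<^sub>v y) = (A * A\<^sup>T) *\<^sub>v y"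
    using A y by simp
  also have "\<dots> = A *\<^sub>v x"
    unfolding y_def using A x E
    by (simp flip: assoc_mult_mat_vec[OF B E(1)] del: assoc_mult_mat_vec)
  finally have "A *\<^sub>v k = 0\<^sub>v n"
    unfolding k_def using A x y by (simp add: mult_minus_distrib_mat_vec[of _ n c])
  moreover have "x = k + A\<^sup>T *\<^sub>v y"
    unfolding k_def using A x y by (intro eq_vecI) auto
  ultimately show ?thesis using that y k by blast
qed

lemma pythagoras:
  fixes A :: "real mat"
  assumes A: "A \<in> carrier_mat n c" and k: "k \<in> carrier_vec c" "A *\<^sub>v k = 0\<^sub>v n"
    and y: "y \<in> carrier_vec n"
  shows "(euclidean_norm (k + A\<^sup>T *\<^sub>v y))\<^sup>2 = (euclidean_norm k)\<^sup>2 + (euclidean_norm (A\<^sup>T *\<^sub>v y))\<^sup>2"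
proof -
  have p: "A\<^sup>T *\<^sub>v y \<in> carrier_vec c" using A y by simp
  have "(A\<^sup>T *\<^sub>v y) \<bullet> k = 0"
    using transpose_vec_mult_scalar[OF A k(1) y] k(2) y by simp
  then show ?thesis
    using k(1) p comm_scalar_prod[OF p k(1)]
    by (simp add: euclidean_norm_power2 scalar_prod_add_distrib[of _ c]
        add_scalar_prod_distrib[of _ c])
qed

lemma smult_mat_mult_vec:
  fixes B :: "real mat"
  assumes "B \<in> carrier_mat n c" "x \<in> carrier_vec c"
  shows "(k \<cdot>\<^sub>m B) *\<^sub>v x = k \<cdot>\<^sub>v (B *\<^sub>v x)"
  using assms by (intro eq_vecI) auto

lemma constraint_iff_kernel:
  fixes A0 J :: "real mat"
  assumes "A0 \<in> carrier_mat n c" "J \<in> carrier_mat n c" "w \<in> carrier_vec c"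
  shows "A0 *\<^sub>v w = lam \<cdot>\<^sub>v (J *\<^sub>v w) \<longleftrightarrow> (A0 - lam \<cdot>\<^sub>m J) *\<^sub>v w = 0\<^sub>v n"
proof -
  have "(A0 - lam \<cdot>\<^sub>m J) *\<^sub>v w = A0 *\<^sub>v w - lam \<cdot>\<^sub>v (J *\<^sub>v w)"
    using assms by (simp add: minus_mult_distrib_mat_vec[of _ n c] smult_mat_mult_vec[of _ n c])
  then show ?thesis
    using assms by (auto simp: vec_eq_iff)
qed

text \<open>A minimizer is the component of \<open>v\<close> in the kernel of the constraint matrix. Writing
  \<open>v = w + p\<close> with \<open>w\<close> in the kernel and \<open>p\<close> in the row space, Pythagoras gives
  \<open>\<parallel>u - v\<parallel>\<^sup>2 = \<parallel>u - w\<parallel>\<^sup>2 + \<parallel>p\<parallel>\<^sup>2\<close> for every feasible \<open>u\<close>, while \<open>w\<close> itself attains \<open>\<parallel>p\<parallel>\<^sup>2\<close>.\<close>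

lemma solution_least_norm_decomposition:
  fixes A0 J :: "real mat"
  assumes A0: "A0 \<in> carrier_mat n c" and J: "J \<in> carrier_mat n c" and v: "v \<in> carrier_vec c"
    and inj: "\<And>y. y \<in> carrier_vec n \<Longrightarrow> (A0 - lam \<cdot>\<^sub>m J)\<^sup>T *\<^sub>v y = 0\<^sub>v c \<Longrightarrow> y = 0\<^sub>v n"
    and sol: "is_solution A0 J v lam u"
  obtains y where "u \<in> carrier_vec c" "(A0 - lam \<cdot>\<^sub>m J) *\<^sub>v u = 0\<^sub>v n"
    "y \<in> carrier_vec n" "v = u + (A0 - lam \<cdot>\<^sub>m J)\<^sup>T *\<^sub>v y"
proof -
  let ?A = "A0 - lam \<cdot>\<^sub>m J"
  have A: "?A \<in> carrier_mat n c" using J by (simp add: minus_carrier_mat)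
  obtain y w where y: "y \<in> carrier_vec n" and w: "w \<in> carrier_vec c" "?A *\<^sub>v w = 0\<^sub>v n"
    and vw: "v = w + ?A\<^sup>T *\<^sub>v y"
    using row_space_kernel_decomposition[OF A inj v] by metis
  let ?p = "?A\<^sup>T *\<^sub>v y"
  have p: "?p \<in> carrier_vec c" using A y by simp
  have u: "u \<in> carrier_vec c" "?A *\<^sub>v u = 0\<^sub>v n"
    using sol v constraint_iff_kernel[OF A0 J]
    unfolding is_solution_def is_arg_min_def by auto
  have "\<not> (euclidean_norm (w - v))\<^sup>2 < (euclidean_norm (u - v))\<^sup>2"
    using sol v w constraint_iff_kernel[OF A0 J w(1)]
    unfolding is_solution_def is_arg_min_def by auto
  moreover have "(euclidean_norm (w - v))\<^sup>2 = (euclidean_norm ?p)\<^sup>2"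
  proof -
    have "w - v = (-1) \<cdot>\<^sub>v ?p"
      unfolding vw using w p by (intro eq_vecI) auto
    then show ?thesis by (simp add: euclidean_norm_smult)
  qed
  moreover have "(euclidean_norm (u - v))\<^sup>2 = (euclidean_norm (w - u))\<^sup>2 + (euclidean_norm ?p)\<^sup>2"
  proof -
    have "u - v = (-1) \<cdot>\<^sub>v ((w - u) + ?p)"
      unfolding vw using w u p J by (intro eq_vecI) auto
    moreover have "?A *\<^sub>v (w - u) = 0\<^sub>v n"
      using A w u by (simp add: mult_minus_distrib_mat_vec[of _ n c])
    ultimately show ?thesis
      using pythagoras[OF A _ _ y, of "w - u"] w u by (simp add: euclidean_norm_smult)
  qed
  ultimately have "euclidean_norm (w - u) = 0" by simp
  then have wu: "w - u = 0\<^sub>v c"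
    using euclidean_norm_eq_0_iff[of "w - u" c] w u by simp
  have "w = u"
  proof (rule eq_vecI)
    fix i assume "i < dim_vec u"
    then show "w $ i = u $ i"
      using arg_cong[OF wu, of "\<lambda>x. x $ i"] w u by simp
  qed (use w u in auto)
  then show ?thesis using that u y vw by blast
qed

text \<open>The zero vector satisfies the constraint for every \<open>lam\<close>, so a minimizer is at least as close to
  \<open>v\<close> as zero is. This controls the solutions for parameters far from the unperturbed one.\<close>

lemma solution_distance_le:
  fixes A0 J :: "real mat"
  assumes A0: "A0 \<in> carrier_mat n c" and J: "J \<in> carrier_mat n c" and v: "v \<in> carrier_vec c"
    and sol: "is_solution A0 J v lam u"
  shows "u \<in> carrier_vec c" and "euclidean_norm (u - v) \<le> euclidean_norm v"
proof -
  show "u \<in> carrier_vec c"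
    using sol v unfolding is_solution_def is_arg_min_def by auto
  have "A0 *\<^sub>v 0\<^sub>v c = lam \<cdot>\<^sub>v (J *\<^sub>v 0\<^sub>v c)"
    using A0 J by (intro eq_vecI) auto
  then have "\<not> (euclidean_norm (0\<^sub>v c - v))\<^sup>2 < (euclidean_norm (u - v))\<^sup>2"
    using sol v unfolding is_solution_def is_arg_min_def by auto
  moreover have "0\<^sub>v c - v = (-1) \<cdot>\<^sub>v v" using v by (intro eq_vecI) auto
  ultimately have "(euclidean_norm (u - v))\<^sup>2 \<le> (euclidean_norm v)\<^sup>2"
    by (simp add: euclidean_norm_smult not_less)
  then show "euclidean_norm (u - v) \<le> euclidean_norm v"
    by (rule power2_le_imp_le) simp
qed

section \<open>Perturbation of the kernel component\<close>

text \<open>Duality: \<open>\<parallel>J\<^sup>T y\<parallel>\<^sup>2 = y \<bullet> J J\<^sup>T y \<le> \<parallel>y\<parallel> \<parallel>J\<^sup>T y\<parallel>\<close>.\<close>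

lemma contraction_transpose:
  fixes J :: "real mat"
  assumes J: "J \<in> carrier_mat n c"
    and le: "\<And>x. x \<in> carrier_vec c \<Longrightarrow> euclidean_norm (J *\<^sub>v x) \<le> euclidean_norm x"
    and y: "y \<in> carrier_vec n"
  shows "euclidean_norm (J\<^sup>T *\<^sub>v y) \<le> euclidean_norm y"
proof (cases "euclidean_norm (J\<^sup>T *\<^sub>v y) = 0")
  case False
  have z: "J\<^sup>T *\<^sub>v y \<in> carrier_vec c" using J y by simp
  have "euclidean_norm (J\<^sup>T *\<^sub>v y) * euclidean_norm (J\<^sup>T *\<^sub>v y) = y \<bullet> (J *\<^sub>v (J\<^sup>T *\<^sub>v y))"
    using transpose_vec_mult_scalar[OF J z y] euclidean_norm_power2[of "J\<^sup>T *\<^sub>v y"]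
    by (simp add: power2_eq_square)
  also have "\<dots> \<le> euclidean_norm y * euclidean_norm (J *\<^sub>v (J\<^sup>T *\<^sub>v y))"
    using scalar_prod_le_euclidean_norm[of y n "J *\<^sub>v (J\<^sup>T *\<^sub>v y)"] J y by simp
  also have "\<dots> \<le> euclidean_norm y * euclidean_norm (J\<^sup>T *\<^sub>v y)"
    by (intro mult_left_mono le z) simp
  finally show ?thesis
    using False euclidean_norm_nonneg[of "J\<^sup>T *\<^sub>v y"] by simp
qed simp

lemma restriction_mat_contraction:
  assumes "r \<le> c" and x: "x \<in> carrier_vec c"
  shows "euclidean_norm (restriction_mat r c *\<^sub>v x) \<le> euclidean_norm x"
proof -
  have J: "(restriction_mat r c *\<^sub>v x) $ i = x $ i" if "i < r" for i
  proof -
    have "row (restriction_mat r c) i = unit_vec c i"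
      using that assms by (intro eq_vecI) (auto simp: restriction_mat_def)
    then show ?thesis using that assms by (simp add: restriction_mat_def)
  qed
  have "(restriction_mat r c *\<^sub>v x) \<bullet> (restriction_mat r c *\<^sub>v x) = (\<Sum>i = 0..<r. x $ i * x $ i)"
    unfolding scalar_prod_def using J by (intro sum.cong) (auto simp: restriction_mat_def)
  also have "\<dots> \<le> (\<Sum>i = 0..<c. x $ i * x $ i)"
    using assms by (intro sum_mono2) auto
  also have "\<dots> = x \<bullet> x" using x by (simp add: scalar_prod_def)
  finally show ?thesis by (simp add: euclidean_norm_def)
qed

text \<open>By the triangle inequality, since \<open>d J\<^sup>T\<close> has norm at most \<open>\<bar>d\<bar>\<close>: the smallest singular value
  drops by at most \<open>\<bar>d\<bar>\<close>, and full row rank persists as long as \<open>\<bar>d\<bar> < s\<close>.\<close>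

lemma perturbed_transpose_lower_bound:
  fixes A J :: "real mat"
  assumes A: "A \<in> carrier_mat n c" and J: "J \<in> carrier_mat n c"
    and contr: "\<And>x. x \<in> carrier_vec c \<Longrightarrow> euclidean_norm (J *\<^sub>v x) \<le> euclidean_norm x"
    and s: "\<And>y. y \<in> carrier_vec n \<Longrightarrow> s * euclidean_norm y \<le> euclidean_norm (A\<^sup>T *\<^sub>v y)"
    and y: "y \<in> carrier_vec n"
  shows "(s - \<bar>d\<bar>) * euclidean_norm y \<le> euclidean_norm ((A + d \<cdot>\<^sub>m J)\<^sup>T *\<^sub>v y)"
proof -
  let ?z = "(A + d \<cdot>\<^sub>m J)\<^sup>T *\<^sub>v y"
  have "A + d \<cdot>\<^sub>m J \<in> carrier_mat n c" using J by simp
  then have z: "?z \<in> carrier_vec c" using y by simp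
  have zJ: "J\<^sup>T *\<^sub>v y \<in> carrier_vec c" using J y by simp
  have "(A + d \<cdot>\<^sub>m J)\<^sup>T *\<^sub>v y = A\<^sup>T *\<^sub>v y + d \<cdot>\<^sub>v (J\<^sup>T *\<^sub>v y)"
    using A J y by (intro eq_vecI) (auto simp: add_scalar_prod_distrib[of _ n] col_add[of _ n c])
  then have "A\<^sup>T *\<^sub>v y = ?z + (- d) \<cdot>\<^sub>v (J\<^sup>T *\<^sub>v y)"
    using A J y by (intro eq_vecI) auto
  then have "euclidean_norm (A\<^sup>T *\<^sub>v y) \<le> euclidean_norm ?z + \<bar>d\<bar> * euclidean_norm (J\<^sup>T *\<^sub>v y)"
    using euclidean_norm_triangle[OF z, of "(- d) \<cdot>\<^sub>v (J\<^sup>T *\<^sub>v y)"] zJ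
    by (simp add: euclidean_norm_smult)
  also have "\<dots> \<le> euclidean_norm ?z + \<bar>d\<bar> * euclidean_norm y"
    using contraction_transpose[OF J contr y] by (simp add: mult_left_mono)
  finally show ?thesis
    using s[OF y] by (simp add: algebra_simps)
qed

lemma transpose_injective_of_lower_bound:
  fixes B :: "real mat"
  assumes "B \<in> carrier_mat n c"
    and lower: "\<And>y. y \<in> carrier_vec n \<Longrightarrow> s * euclidean_norm y \<le> euclidean_norm (B\<^sup>T *\<^sub>v y)"
    and "0 < s" and y: "y \<in> carrier_vec n" "B\<^sup>T *\<^sub>v y = 0\<^sub>v c"
  shows "y = 0\<^sub>v n"
proof -
  have "s * euclidean_norm y \<le> 0"
    using lower[OF y(1)] y(2) by (simp add: euclidean_norm_def)
  then have "euclidean_norm y = 0"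
    using \<open>0 < s\<close> euclidean_norm_nonneg[of y] by (simp add: mult_le_0_iff)
  then show ?thesis using euclidean_norm_eq_0_iff[OF y(1)] by simp
qed

lemma le_of_mult_self_le:
  fixes a b :: real
  assumes "a * a \<le> b * a" "0 \<le> a" "0 \<le> b"
  shows "a \<le> b"
  using assms by (cases "a = 0") auto

text \<open>The two summands bound the row space part \<open>a = A\<^sup>T q\<close> and the kernel part \<open>k\<close> of the difference
  \<open>\<Delta> = u - u1\<close>, both with respect to \<open>A\<close>.

  The row space part is small because \<open>A \<Delta> = - A u1 = d J u1\<close>, whence
  \<open>\<parallel>a\<parallel>\<^sup>2 = q \<bullet> A \<Delta> \<le> \<bar>d\<bar> \<parallel>q\<parallel> \<parallel>u1\<parallel>\<close> and \<open>\<parallel>q\<parallel> \<le> \<parallel>a\<parallel> / s\<close>.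

  The kernel part is small because \<open>\<Delta> = A1\<^sup>T y1 - A\<^sup>T y\<close> with \<open>A1 = A + d J\<close>, and \<open>k\<close> is orthogonal
  to the row space of \<open>A\<close>, whence \<open>\<parallel>k\<parallel>\<^sup>2 = k \<bullet> \<Delta> = y1 \<bullet> A1 k = d (y1 \<bullet> J k)\<close>. Here
  \<open>\<parallel>y1\<parallel> \<le> \<parallel>v\<parallel> / (s - \<bar>d\<bar>)\<close> by the singular value bound for \<open>A1\<close>.\<close>

lemma kernel_projection_perturbation:
  fixes A J :: "real mat"
  assumes A: "A \<in> carrier_mat n c" and J: "J \<in> carrier_mat n c"
    and contr: "\<And>x. x \<in> carrier_vec c \<Longrightarrow> euclidean_norm (J *\<^sub>v x) \<le> euclidean_norm x"
    and s: "\<And>y. y \<in> carrier_vec n \<Longrightarrow> s * euclidean_norm y \<le> euclidean_norm (A\<^sup>T *\<^sub>v y)"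
    and d: "\<bar>d\<bar> < s"
    and u: "u \<in> carrier_vec c" "A *\<^sub>v u = 0\<^sub>v n"
    and y: "y \<in> carrier_vec n" "v = u + A\<^sup>T *\<^sub>v y"
    and u1: "u1 \<in> carrier_vec c" "(A + d \<cdot>\<^sub>m J) *\<^sub>v u1 = 0\<^sub>v n"
    and y1: "y1 \<in> carrier_vec n" "v = u1 + (A + d \<cdot>\<^sub>m J)\<^sup>T *\<^sub>v y1"
  shows "euclidean_norm (u - u1)
    \<le> \<bar>d\<bar> / s * euclidean_norm v + \<bar>d\<bar> / (s - \<bar>d\<bar>) * euclidean_norm v"
proof -
  let ?A1 = "A + d \<cdot>\<^sub>m J" and ?\<Delta> = "u - u1"
  have A1: "?A1 \<in> carrier_mat n c" using A J by simp
  have s0: "0 < s" using d by linarith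
  have A1x: "z \<bullet> (?A1 *\<^sub>v x) = z \<bullet> (A *\<^sub>v x) + d * (z \<bullet> (J *\<^sub>v x))"
    if "x \<in> carrier_vec c" "z \<in> carrier_vec n" for x z
    using A J that
    by (simp add: add_mult_distrib_mat_vec[of _ n c] smult_mat_mult_vec[of _ n c]
        scalar_prod_add_distrib[of _ n])
  note inj = transpose_injective_of_lower_bound[OF A s s0]
  have \<Delta>: "?\<Delta> \<in> carrier_vec c" using u u1 by simp
  obtain q k where q: "q \<in> carrier_vec n" and k: "k \<in> carrier_vec c" "A *\<^sub>v k = 0\<^sub>v n"
    and dec: "?\<Delta> = k + A\<^sup>T *\<^sub>v q"
    using row_space_kernel_decomposition[OF A inj \<Delta>] by metis
  let ?a = "A\<^sup>T *\<^sub>v q"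
  have a: "?a \<in> carrier_vec c" using A q by simp
  have u1v: "euclidean_norm u1 \<le> euclidean_norm v"
    and py: "euclidean_norm (?A1\<^sup>T *\<^sub>v y1) \<le> euclidean_norm v"
    using pythagoras[OF A1 u1 y1(1)] unfolding y1(2)[symmetric]
    by (auto intro: power2_le_imp_le)
  have "euclidean_norm ?a * euclidean_norm ?a \<le> \<bar>d\<bar> / s * euclidean_norm v * euclidean_norm ?a"
  proof -
    have "euclidean_norm ?a * euclidean_norm ?a = q \<bullet> (A *\<^sub>v ?a)"
      using transpose_vec_mult_scalar[OF A a q] euclidean_norm_power2[of ?a]
      by (simp add: power2_eq_square)
    also have "\<dots> = q \<bullet> (A *\<^sub>v ?\<Delta>)"
      unfolding dec using A k a by (simp add: mult_add_distrib_mat_vec[of _ n c])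
    also have "\<dots> = - (q \<bullet> (A *\<^sub>v u1))"
      using A u u1 q
      by (simp add: mult_minus_distrib_mat_vec[of _ n c] scalar_prod_minus_distrib[of _ n])
    also have "\<dots> = d * (q \<bullet> (J *\<^sub>v u1))"
      using A1x[OF u1(1) q] u1(2) q by simp
    also have "\<dots> \<le> \<bar>d\<bar> * \<bar>q \<bullet> (J *\<^sub>v u1)\<bar>"
      by (simp flip: abs_mult)
    also have "\<dots> \<le> \<bar>d\<bar> * (euclidean_norm q * euclidean_norm (J *\<^sub>v u1))"
      using scalar_prod_le_euclidean_norm[OF q, of "J *\<^sub>v u1"] J u1 by (intro mult_left_mono) auto
    also have "\<dots> \<le> \<bar>d\<bar> * ((euclidean_norm ?a / s) * euclidean_norm v)"
      using s[OF q] s0 contr[OF u1(1)] u1v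
      by (intro mult_left_mono mult_mono) (auto simp: field_simps)
    finally show ?thesis by (simp add: field_simps)
  qed
  then have a_le: "euclidean_norm ?a \<le> \<bar>d\<bar> / s * euclidean_norm v"
    by (rule le_of_mult_self_le) (use s0 in auto)
  have "euclidean_norm k * euclidean_norm k
    \<le> \<bar>d\<bar> / (s - \<bar>d\<bar>) * euclidean_norm v * euclidean_norm k"
  proof -
    have pk: "(A\<^sup>T *\<^sub>v z) \<bullet> k = 0" if "z \<in> carrier_vec n" for z
      using transpose_vec_mult_scalar[OF A k(1) that] k(2) that by simp
    have "?\<Delta> = ?A1\<^sup>T *\<^sub>v y1 - A\<^sup>T *\<^sub>v y"
    proof (rule eq_vecI)
      fix i assume "i < dim_vec (?A1\<^sup>T *\<^sub>v y1 - A\<^sup>T *\<^sub>v y)"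
      then have i: "i < c" using A by simp
      then have "u $ i + (A\<^sup>T *\<^sub>v y) $ i = v $ i"
        using A by (simp add: y(2))
      moreover have "u1 $ i + (?A1\<^sup>T *\<^sub>v y1) $ i = v $ i"
        using i A1 A J by (simp add: y1(2))
      ultimately show "?\<Delta> $ i = (?A1\<^sup>T *\<^sub>v y1 - A\<^sup>T *\<^sub>v y) $ i"
        using i A u1 by simp
    qed (use A u1 in auto)
    then have "?\<Delta> \<bullet> k = y1 \<bullet> (?A1 *\<^sub>v k)"
      using transpose_vec_mult_scalar[OF A1 k(1) y1(1)] pk[OF y(1)] A A1 y y1 k
      by (simp add: minus_scalar_prod_distrib[of _ c])
    also have "\<dots> = d * (y1 \<bullet> (J *\<^sub>v k))"
      using A1x[OF k(1) y1(1)] k(2) y1 by simp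
    finally have "d * (y1 \<bullet> (J *\<^sub>v k)) = ?\<Delta> \<bullet> k" by simp
    also have "\<dots> = euclidean_norm k * euclidean_norm k"
      unfolding dec using pk[OF q] k a euclidean_norm_power2[of k]
      by (simp add: add_scalar_prod_distrib[of _ c] power2_eq_square)
    finally have "euclidean_norm k * euclidean_norm k = d * (y1 \<bullet> (J *\<^sub>v k))" by simp
    also have "\<dots> \<le> \<bar>d\<bar> * \<bar>y1 \<bullet> (J *\<^sub>v k)\<bar>"
      by (simp flip: abs_mult)
    also have "\<dots> \<le> \<bar>d\<bar> * (euclidean_norm y1 * euclidean_norm (J *\<^sub>v k))"
      using scalar_prod_le_euclidean_norm[OF y1(1), of "J *\<^sub>v k"] J k by (intro mult_left_mono) auto
    also have "\<dots> \<le> \<bar>d\<bar> * ((euclidean_norm v / (s - \<bar>d\<bar>)) * euclidean_norm k)"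
    proof -
      have "(s - \<bar>d\<bar>) * euclidean_norm y1 \<le> euclidean_norm v"
        using perturbed_transpose_lower_bound[OF A J contr s y1(1), of d] py by linarith
      then have "euclidean_norm y1 \<le> euclidean_norm v / (s - \<bar>d\<bar>)"
        using d by (simp add: field_simps)
      then show ?thesis
        using contr[OF k(1)] d by (intro mult_left_mono mult_mono) auto
    qed
    finally show ?thesis by (simp add: field_simps)
  qed
  then have k_le: "euclidean_norm k \<le> \<bar>d\<bar> / (s - \<bar>d\<bar>) * euclidean_norm v"
    by (rule le_of_mult_self_le) (use d in auto)
  have "euclidean_norm ?\<Delta> \<le> euclidean_norm k + euclidean_norm ?a"
    unfolding dec by (rule euclidean_norm_triangle[OF k(1) a])
  with a_le k_le show ?thesis by linarith
qed

text \<open>Replacing \<open>1 / (s - e)\<close> by \<open>1 / s\<close> costs at most \<open>2 e / s\<^sup>2\<close>. The constant \<open>4\<close> instead of \<open>2\<close>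
  makes the same remainder \<open>4 V e\<^sup>2 / s\<^sup>2\<close> reach \<open>V\<close> as soon as \<open>e \<ge> s / 2\<close>, which is what the
  parameters outside the range of this lemma require.\<close>

lemma second_order_remainder:
  fixes e s V :: real
  assumes "0 \<le> e" "e \<le> s / 2" "0 < s" "0 \<le> V"
  shows "e / s * V + e / (s - e) * V \<le> 2 * inverse s * e * V + 4 * V / s\<^sup>2 * e\<^sup>2"
proof -
  have "1 / (s - e) \<le> 1 / s + 2 * e / s\<^sup>2"
  proof -
    have "s\<^sup>2 \<le> (s + 2 * e) * (s - e)"
      using mult_nonneg_nonneg[of e "s - 2 * e"] assms by (simp add: algebra_simps power2_eq_square)
    then show ?thesis
      using assms by (simp add: field_simps power2_eq_square)
  qed
  then have "e * V * (1 / (s - e)) \<le> e * V * (1 / s + 2 * e / s\<^sup>2)"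
    using assms by (intro mult_left_mono) auto
  then have "e / s * V + e / (s - e) * V \<le> e / s * V + e * V * (1 / s + 2 * e / s\<^sup>2)"
    by simp
  also have "\<dots> = 2 * inverse s * e * V + 2 * V / s\<^sup>2 * e\<^sup>2"
    by (simp add: divide_inverse power2_eq_square algebra_simps)
  also have "\<dots> \<le> 2 * inverse s * e * V + 4 * V / s\<^sup>2 * e\<^sup>2"
    using assms by (intro add_left_mono mult_right_mono divide_right_mono) auto
  finally show ?thesis .
qed

theorem theorem3p1:
  fixes N M :: nat and A0 A J :: "real mat" and v u :: "real vec" and lam :: real
  assumes "N \<ge> 3" and "M \<ge> 3"
    and "A0 \<in> carrier_mat ((N - 2) * (M - 2)) (N * M)"
    and "J = restriction_mat ((N - 2) * (M - 2)) (N * M)"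
    and "v \<in> carrier_vec (N * M)"
    and "A = A0 - lam \<cdot>\<^sub>m J"
    and "full_row_rank A"
    and "is_solution A0 J v lam u"
  shows "\<exists>R \<in> O[at_right 0](\<lambda>\<epsilon>::real. \<epsilon>\<^sup>2). \<forall>\<epsilon> lam1 u1.
           \<bar>lam - lam1\<bar> = \<epsilon> \<longrightarrow> is_solution A0 J v lam1 u1 \<longrightarrow>
           euclidean_norm (u - u1)
             \<le> 2 * inverse (smallest_singular_value A) * \<epsilon> * euclidean_norm v + R \<epsilon>"
proof -
  define n c where "n = (N - 2) * (M - 2)" and "c = N * M"
  define s where "s = smallest_singular_value A"
  \<comment> \<open>One quadratic function serves for all \<open>\<epsilon>\<close>, small or large.\<close>
  let ?V = "euclidean_norm v"
  define R where "R = (\<lambda>\<epsilon>. 4 * ?V / s\<^sup>2 * \<epsilon>\<^sup>2)"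
  have n: "0 < n" "n \<le> c"
    using assms(1,2) by (auto simp: n_def c_def intro!: mult_le_mono)
  have A0: "A0 \<in> carrier_mat n c" and v: "v \<in> carrier_vec c"
    using assms(3,5) by (auto simp: n_def c_def)
  have J_eq: "J = restriction_mat n c" using assms(4) by (simp add: n_def c_def)
  have J: "J \<in> carrier_mat n c" by (simp add: J_eq restriction_mat_def)
  have contr: "euclidean_norm (J *\<^sub>v x) \<le> euclidean_norm x" if "x \<in> carrier_vec c" for x
    unfolding J_eq by (rule restriction_mat_contraction[OF n(2) that])
  have A: "A \<in> carrier_mat n c" using J assms(6) by (simp add: minus_carrier_mat)
  have s0: "0 < s"
    unfolding s_def by (rule smallest_singular_value_lower_bound(1)[OF A n(1) assms(7)])
  have s: "s * euclidean_norm y \<le> euclidean_norm (A\<^sup>T *\<^sub>v y)" if "y \<in> carrier_vec n" for y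
    unfolding s_def by (rule smallest_singular_value_lower_bound(2)[OF A n(1) assms(7) that])
  have bound: "euclidean_norm (u - u1) \<le> 2 * inverse s * \<epsilon> * ?V + R \<epsilon>"
    if \<epsilon>: "\<bar>lam - lam1\<bar> = \<epsilon>" and sol1: "is_solution A0 J v lam1 u1" for \<epsilon> lam1 u1
  proof (cases "\<epsilon> \<le> s / 2")
    case True
    let ?d = "lam - lam1"
    have A1: "A0 - lam1 \<cdot>\<^sub>m J = A + ?d \<cdot>\<^sub>m J"
      unfolding assms(6) using A0 J by (intro eq_matI) (auto simp: algebra_simps)
    have d: "\<bar>?d\<bar> < s" using True \<epsilon> s0 by simp
    note inj = transpose_injective_of_lower_bound[OF A s s0]
    have B: "A + ?d \<cdot>\<^sub>m J \<in> carrier_mat n c" using J by simp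
    have "0 < s - \<bar>?d\<bar>" using d by simp
    note inj1 = transpose_injective_of_lower_bound
      [OF B perturbed_transpose_lower_bound[OF A J contr s] this]
    obtain y where y: "u \<in> carrier_vec c" "A *\<^sub>v u = 0\<^sub>v n" "y \<in> carrier_vec n" "v = u + A\<^sup>T *\<^sub>v y"
      using solution_least_norm_decomposition[OF A0 J v _ assms(8)] inj
      unfolding assms(6)[symmetric] by metis
    obtain y1 where y1: "u1 \<in> carrier_vec c" "(A + ?d \<cdot>\<^sub>m J) *\<^sub>v u1 = 0\<^sub>v n"
      "y1 \<in> carrier_vec n" "v = u1 + (A + ?d \<cdot>\<^sub>m J)\<^sup>T *\<^sub>v y1"
      using solution_least_norm_decomposition[OF A0 J v _ sol1] inj1
      unfolding A1 by metis
    have "euclidean_norm (u - u1) \<le> \<epsilon> / s * ?V + \<epsilon> / (s - \<epsilon>) * ?V"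
      using kernel_projection_perturbation[OF A J contr s d y y1] unfolding \<epsilon> .
    also have "\<dots> \<le> 2 * inverse s * \<epsilon> * ?V + 4 * ?V / s\<^sup>2 * \<epsilon>\<^sup>2"
      using True \<epsilon> s0 by (intro second_order_remainder) auto
    finally show ?thesis unfolding R_def .
  next
    case False
    \<comment> \<open>Both solutions lie within \<open>\<parallel>v\<parallel>\<close> of \<open>v\<close>; the linear term and the remainder each exceed
      \<open>\<parallel>v\<parallel>\<close> once \<open>2 \<epsilon> / s \<ge> 1\<close>.\<close>
    note u = solution_distance_le[OF A0 J v assms(8)]
    note u1 = solution_distance_le[OF A0 J v sol1]
    have "u - u1 = (u - v) + (-1) \<cdot>\<^sub>v (u1 - v)"
      using u(1) u1(1) v by (intro eq_vecI) auto
    then have "euclidean_norm (u - u1) \<le> euclidean_norm (u - v) + euclidean_norm (u1 - v)"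
      using euclidean_norm_triangle[of "u - v" c "(-1) \<cdot>\<^sub>v (u1 - v)"] u(1) u1(1) v
      by (simp add: euclidean_norm_smult)
    then have far: "euclidean_norm (u - u1) \<le> 2 * ?V"
      using u(2) u1(2) by linarith
    have r: "1 \<le> 2 * \<epsilon> / s" using False s0 by (simp add: field_simps)
    have "1 * ?V \<le> (2 * \<epsilon> / s) * ?V"
      using r by (intro mult_right_mono) auto
    moreover have "1\<^sup>2 * ?V \<le> (2 * \<epsilon> / s)\<^sup>2 * ?V"
      using r by (intro mult_right_mono power_mono) auto
    moreover have "(2 * \<epsilon> / s) * ?V = 2 * inverse s * \<epsilon> * ?V"
      by (simp add: divide_inverse)
    moreover have "(2 * \<epsilon> / s)\<^sup>2 * ?V = R \<epsilon>"
      unfolding R_def by (simp add: power_divide power_mult_distrib)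
    ultimately show ?thesis using far by simp
  qed
  have "R \<in> O[at_right 0](\<lambda>\<epsilon>. \<epsilon>\<^sup>2)"
    unfolding R_def by (intro bigoI[of _ "4 * ?V / s\<^sup>2"]) simp
  with bound show ?thesis unfolding s_def by blast
qed

end
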